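(* For any $u,v\in S_n$ there exists a sequence $\mathbf{a}\in[n]^n$ such that $u\le_{\mathbf{a}}v$. Furthermore, there exists a sequence $\mathbf{a}\in[n]^n$ such that $u\lesssim_{\mathbf{a}}v$.
   Context: Permutations are in one-line notation $w=w_1\cdots w_n$, $w[k]:=\{w_1,\dots,w_k\}$. For $a,b\in[n]$ the cyclic interval $[a,b)_c$ is $\{a,a+1,\dots,b-1\}$ if $a\le b$ (so $[a,a)_c=\emptyset$) and $\{a,\dots,n\}\cup\{1,\dots,b-1\}$ if $a>b$. For $r\in[n]$ the shifted linear order $<_r$ on $[n]$ is $r<_r r+1<_r\cdots<_r n<_r 1<_r\cdots<_r r-1$. For $k$-subsets $A=\{a_1<_r\cdots<_r a_k\}$ and $B=\{b_1<_r\cdots<_r b_k\}$ of $[n]$, $A\le_r B$ (shifted Gale order) means $a_i\le_r b_i$ for all $i$. For $\mathbf{a}=(a_1,\dots,a_n)\in[n]^n$: $u\le_{\mathbf{a}}v$ means $u[k]\le_{a_k}v[k]$ for all $k\in[n]$; $u\sim_{\mathbf{a}}v$ means $|u[k]\cap[a_k,a_{k+1})_c|=|v[k]\cap[a_k,a_{k+1})_c|$ for all $k\in[n-1]$; and $u\lesssim_{\mathbf{a}}v$ means both $u\le_{\mathbf{a}}v$ and $u\sim_{\mathbf{a}}v$. *)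

theory Defs
  imports "HOL-Combinatorics.Permutations" "HOL-Library.FuncSet"
begin

text \<open>
  The ground set \<open>[n]\<close> is \<open>{1..n}\<close>; a permutation \<open>w = w\<^sub>1 \<dots> w\<^sub>n\<close> is a function
  with \<open>w permutes {1..n}\<close> and \<open>w\<^sub>i = w i\<close>, so \<open>w[k]\<close> is the following image.
\<close>

definition prefix_set :: "(nat \<Rightarrow> nat) \<Rightarrow> nat \<Rightarrow> nat set" where
  "prefix_set w k = w ` {1..k}"

definition cyclic_interval :: "nat \<Rightarrow> nat \<Rightarrow> nat \<Rightarrow> nat set" where
  "cyclic_interval n a b = (if a \<le> b then {a..<b} else {a..n} \<union> {1..<b})"

text \<open>
  The order \<open>r < r+1 < \<dots> < n < 1 < \<dots> < r-1\<close>: elements \<open>\<ge> r\<close> precede elements \<open>< r\<close>,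
  and each of the two blocks carries the usual order.  The formula does not depend on \<open>n\<close>.
\<close>

definition shifted_less :: "nat \<Rightarrow> nat \<Rightarrow> nat \<Rightarrow> bool" where
  "shifted_less r x y \<longleftrightarrow>
     (r \<le> x \<and> r \<le> y \<and> x < y) \<or> (x < r \<and> y < r \<and> x < y) \<or> (r \<le> x \<and> y < r)"

definition shifted_le :: "nat \<Rightarrow> nat \<Rightarrow> nat \<Rightarrow> bool" where
  "shifted_le r x y \<longleftrightarrow> shifted_less r x y \<or> x = y"

text \<open>
  The lists \<open>xs\<close>, \<open>ys\<close> are the (unique) increasing enumerations of \<open>A\<close> and \<open>B\<close> in the
  shifted order; \<open>list_all2\<close> forces them to have the same length.
\<close>

definition gale_le :: "nat \<Rightarrow> nat set \<Rightarrow> nat set \<Rightarrow> bool" where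
  "gale_le r A B \<longleftrightarrow>
     (\<exists>xs ys. sorted_wrt (shifted_less r) xs \<and> set xs = A \<and>
              sorted_wrt (shifted_less r) ys \<and> set ys = B \<and>
              list_all2 (shifted_le r) xs ys)"

definition seq_le :: "nat \<Rightarrow> (nat \<Rightarrow> nat) \<Rightarrow> (nat \<Rightarrow> nat) \<Rightarrow> (nat \<Rightarrow> nat) \<Rightarrow> bool" where
  "seq_le n a u v \<longleftrightarrow> (\<forall>k\<in>{1..n}. gale_le (a k) (prefix_set u k) (prefix_set v k))"

definition seq_sim :: "nat \<Rightarrow> (nat \<Rightarrow> nat) \<Rightarrow> (nat \<Rightarrow> nat) \<Rightarrow> (nat \<Rightarrow> nat) \<Rightarrow> bool" where
  "seq_sim n a u v \<longleftrightarrow>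
     (\<forall>k\<in>{1..<n}. card (prefix_set u k \<inter> cyclic_interval n (a k) (a (Suc k)))
                 = card (prefix_set v k \<inter> cyclic_interval n (a k) (a (Suc k))))"

definition seq_lesssim :: "nat \<Rightarrow> (nat \<Rightarrow> nat) \<Rightarrow> (nat \<Rightarrow> nat) \<Rightarrow> (nat \<Rightarrow> nat) \<Rightarrow> bool" where
  "seq_lesssim n a u v \<longleftrightarrow> seq_le n a u v \<and> seq_sim n a u v"

end

theory Submission
  imports Defs
begin

text \<open>
  For \<open>k \<in> {0..n}\<close> and \<open>a \<in> {1..n}\<close> let \<open>D\<^sub>k a = \<bar>u[k] \<inter> {1..<a}\<bar> - \<bar>v[k] \<inter> {1..<a}\<bar>\<close>. Then
  \<open>u[k] \<le>\<^sub>a v[k]\<close> as soon as \<open>a\<close> minimises \<open>D\<^sub>k\<close>, and \<open>u[k]\<close>, \<open>v[k]\<close> meet the cyclic interval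
  from \<open>a\<close> to \<open>b\<close> equally often iff \<open>D\<^sub>k a = D\<^sub>k b\<close>. It thus suffices to choose \<open>a\<^sub>k\<close> as a common
  minimiser of \<open>D\<^bsub>k-1\<^esub>\<close> and \<open>D\<^sub>k\<close>. One exists because \<open>D\<^sub>k - D\<^bsub>k-1\<^esub>\<close> takes at most two
  values, which are consecutive integers: any minimiser of \<open>D\<^bsub>k-1\<^esub> + D\<^sub>k\<close> will do.
\<close>

text \<open>If \<open>ys ! i < xs ! i\<close>, then at least \<open>Suc i\<close> elements of
  \<open>B\<close> lie up to \<open>ys ! i\<close>, but at most \<open>i\<close> elements of
  \<open>A\<close> do, as these occupy indices below \<open>i\<close>. Stating this for any linear
  order lets it be applied to every shifted order.\<close>

lemma (in linorder) list_all2_sorted_list_of_set: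
  assumes "finite A" "finite B" "card A = card B"
    and le: "\<And>x. x \<in> B \<Longrightarrow> card {y \<in> B. y \<le> x} \<le> card {y \<in> A. y \<le> x}"
  shows "list_all2 (\<le>) (sorted_list_of_set A) (sorted_list_of_set B)"
proof (rule list_all2_all_nthI)
  define xs ys where "xs = sorted_list_of_set A" and "ys = sorted_list_of_set B"
  have xs: "sorted_wrt (<) xs" "set xs = A" "length xs = card A"
    and ys: "sorted_wrt (<) ys" "set ys = B" "length ys = card B"
    using assms by (simp_all add: xs_def ys_def)
  show "length (sorted_list_of_set A) = length (sorted_list_of_set B)"
    using assms by simp
  fix i assume "i < length (sorted_list_of_set A)"
  then have i: "i < length xs" "i < length ys"
    using xs ys assms by (simp_all add: xs_def)
  have "xs ! i \<le> ys ! i"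
  proof (rule ccontr)
    assume "\<not> xs ! i \<le> ys ! i"
    then have gt: "ys ! i < xs ! i" by simp
    have "distinct ys" using ys(1) strict_sorted_iff by blast
    then have "Suc i = card ((!) ys ` {..i})"
      using i by (subst card_image) (auto simp: inj_on_def nth_eq_iff_index_eq)
    also have "\<dots> \<le> card {y \<in> B. y \<le> ys ! i}"
    proof (rule card_mono)
      have "ys ! j \<le> ys ! i" if "j \<le> i" for j
        using that i sorted_wrt_nth_less[OF ys(1), of j i] by (cases "j = i") auto
      then show "(!) ys ` {..i} \<subseteq> {y \<in> B. y \<le> ys ! i}"
        using i ys(2) by auto
    qed (use assms in simp)
    also have "\<dots> \<le> card {y \<in> A. y \<le> ys ! i}"
      using le i ys(2) by auto
    also have "\<dots> \<le> card ((!) xs ` {..<i})"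
    proof (rule card_mono)
      show "{y \<in> A. y \<le> ys ! i} \<subseteq> (!) xs ` {..<i}"
      proof
        fix y assume y: "y \<in> {y \<in> A. y \<le> ys ! i}"
        then obtain j where j: "j < length xs" "y = xs ! j"
          using xs(2) by (auto simp: in_set_conv_nth)
        have "xs ! j < xs ! i" using y j gt by auto
        then have "i \<noteq> j" "\<not> i < j"
          using sorted_wrt_nth_less[OF xs(1), of i j] j by auto
        then show "y \<in> (!) xs ` {..<i}" using j by auto
      qed
    qed simp
    also have "\<dots> \<le> i"
      using card_image_le[of "{..<i}" "(!) xs"] by simp
    finally show False by simp
  qed
  then show "sorted_list_of_set A ! i \<le> sorted_list_of_set B ! i"
    by (simp add: xs_def ys_def)
qed

lemma linorder_shifted: "class.linorder (shifted_le r) (shifted_less r)"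
  by standard (auto simp: shifted_le_def shifted_less_def)

lemma gale_leI:
  assumes "finite A" "finite B" "card A = card B"
    and "\<And>x. x \<in> B \<Longrightarrow> card {y \<in> B. shifted_le r y x} \<le> card {y \<in> A. shifted_le r y x}"
  shows "gale_le r A B"
proof -
  interpret shifted: linorder "shifted_le r" "shifted_less r"
    by (rule linorder_shifted)
  show ?thesis
    unfolding gale_le_def
  proof (intro exI conjI)
    show "list_all2 (shifted_le r) (shifted.sorted_list_of_set A) (shifted.sorted_list_of_set B)"
      using assms by (rule shifted.list_all2_sorted_list_of_set)
  qed (use assms in simp_all)
qed

text \<open>Integer-valued because the difference may be negative.\<close>

definition prefix_diff :: "nat set \<Rightarrow> nat set \<Rightarrow> nat \<Rightarrow> int" where
  "prefix_diff A B a = int (card (A \<inter> {1..<a})) - int (card (B \<inter> {1..<a}))"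

text \<open>An initial segment of the order shifted by \<open>a\<close> is an ordinary interval if
  \<open>a \<le> x\<close>. Otherwise it wraps past \<open>n\<close>, which adds
  \<open>card A\<close>, a term that cancels between sets of equal size.\<close>

lemma card_shifted_segment:
  assumes "A \<subseteq> {1..n}" "a \<in> {1..n}"
  shows "int (card {y \<in> A. shifted_le a y x}) =
    int (card (A \<inter> {1..<Suc x})) - int (card (A \<inter> {1..<a})) + (if a \<le> x then 0 else int (card A))"
proof -
  have fin: "finite A" using assms finite_subset by blast
  show ?thesis
  proof (cases "a \<le> x")
    case True
    have "A \<inter> {1..<Suc x} = {y \<in> A. shifted_le a y x} \<union> (A \<inter> {1..<a})"
      using True assms by (auto simp: shifted_le_def shifted_less_def)
    moreover have "{y \<in> A. shifted_le a y x} \<inter> (A \<inter> {1..<a}) = {}"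
      using True by (auto simp: shifted_le_def shifted_less_def)
    ultimately show ?thesis using True fin by (simp add: card_Un_disjoint)
  next
    case False
    have "{y \<in> A. shifted_le a y x} = (A - {1..<a}) \<union> (A \<inter> {1..<Suc x})"
      using False assms by (auto simp: shifted_le_def shifted_less_def)
    moreover have "(A - {1..<a}) \<inter> (A \<inter> {1..<Suc x}) = {}"
      using False by auto
    moreover have "card A = card (A - {1..<a}) + card (A \<inter> {1..<a})"
      using fin by (metis add.commute card_Int_Diff)
    ultimately show ?thesis using False fin by (simp add: card_Un_disjoint)
  qed
qed

lemma card_cyclic_interval:
  assumes "A \<subseteq> {1..n}" "a \<in> {1..n}" "b \<in> {1..n}"
  shows "int (card (A \<inter> cyclic_interval n a b)) =
    int (card (A \<inter> {1..<b})) - int (card (A \<inter> {1..<a})) + (if a \<le> b then 0 else int (card A))"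
proof -
  have fin: "finite A" using assms finite_subset by blast
  show ?thesis
  proof (cases "a \<le> b")
    case True
    have "A \<inter> {1..<b} = (A \<inter> {a..<b}) \<union> (A \<inter> {1..<a})"
      using True assms by auto
    moreover have "(A \<inter> {a..<b}) \<inter> (A \<inter> {1..<a}) = {}"
      by auto
    ultimately show ?thesis
      using True fin by (simp add: card_Un_disjoint cyclic_interval_def)
  next
    case False
    have "A \<inter> cyclic_interval n a b = (A - {1..<a}) \<union> (A \<inter> {1..<b})"
      using False assms by (auto simp: cyclic_interval_def)
    moreover have "(A - {1..<a}) \<inter> (A \<inter> {1..<b}) = {}"
      using False by auto
    moreover have "card A = card (A - {1..<a}) + card (A \<inter> {1..<a})"
      using fin by (metis add.commute card_Int_Diff)
    ultimately show ?thesis using False fin by (simp add: card_Un_disjoint)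
  qed
qed

text \<open>By \<open>card_shifted_segment\<close>, the surplus of \<open>A\<close> over
  \<open>B\<close> on the segment up to \<open>x\<close> is
  \<open>prefix_diff A B (Suc x) - prefix_diff A B a\<close>, so minimality makes it
  nonnegative.\<close>

lemma gale_le_if_minimum:
  assumes A: "A \<subseteq> {1..n}" and B: "B \<subseteq> {1..n}" and card: "card A = card B"
    and a: "a \<in> {1..n}"
    and min: "\<And>b. b \<in> {1..n} \<Longrightarrow> prefix_diff A B a \<le> prefix_diff A B b"
  shows "gale_le a A B"
proof (rule gale_leI)
  fix x assume "x \<in> B"
  have "prefix_diff A B a \<le> prefix_diff A B (Suc x)"
  proof (cases "Suc x \<le> n")
    case True
    then show ?thesis using min by simp
  next
    \<comment> \<open>Here \<open>Suc x\<close> is \<open>n + 1\<close>, outside the range of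
      \<open>min\<close>. Both sets are then counted in full, so the difference is 0, as at
      1.\<close>
    case False
    then have "A \<inter> {1..<Suc x} = A" "B \<inter> {1..<Suc x} = B" using A B by auto
    then have "prefix_diff A B (Suc x) = prefix_diff A B 1"
      using card by (simp add: prefix_diff_def)
    then show ?thesis using min[of 1] a by simp
  qed
  then show "card {y \<in> B. shifted_le a y x} \<le> card {y \<in> A. shifted_le a y x}"
    unfolding of_nat_le_iff[where ?'a = int, symmetric] prefix_diff_def
      card_shifted_segment[OF A a] card_shifted_segment[OF B a] card
    by linarith
qed (use A B card finite_subset in auto)

text \<open>The wrap-around terms agree since \<open>card A = card B\<close>. The two counts thus
  differ by \<open>prefix_diff A B b - prefix_diff A B a\<close>.\<close>

lemma card_cyclic_interval_eq_iff:
  assumes "A \<subseteq> {1..n}" "B \<subseteq> {1..n}" "card A = card B" "a \<in> {1..n}" "b \<in> {1..n}"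
  shows "card (A \<inter> cyclic_interval n a b) = card (B \<inter> cyclic_interval n a b) \<longleftrightarrow>
    prefix_diff A B a = prefix_diff A B b"
  unfolding of_nat_eq_iff[where ?'a = int, symmetric] prefix_diff_def
    card_cyclic_interval[OF assms(1,4,5)] card_cyclic_interval[OF assms(2,4,5)] assms(3)
  by linarith

text \<open>If one of \<open>f\<close>, \<open>g\<close> drops from \<open>x\<close> to
  \<open>y\<close>, it drops by at least 1. As \<open>g - f\<close> varies by at most 1, the other
  cannot rise, so \<open>f + g\<close> drops too, against the choice of \<open>x\<close>.\<close>

lemma common_minimum:
  fixes f g :: "'a \<Rightarrow> int"
  assumes "finite S" "S \<noteq> {}" and diff: "\<And>x. x \<in> S \<Longrightarrow> g x - f x \<in> {c, c + 1}"
  obtains x where "x \<in> S" "\<And>y. y \<in> S \<Longrightarrow> f x \<le> f y" "\<And>y. y \<in> S \<Longrightarrow> g x \<le> g y"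
proof -
  obtain x where x: "x \<in> S" "\<And>y. y \<in> S \<Longrightarrow> f x + g x \<le> f y + g y"
    using ex_is_arg_min_if_finite[OF assms(1,2), of "\<lambda>x. f x + g x"]
    by (auto simp: is_arg_min_linorder)
  have "f x \<le> f y \<and> g x \<le> g y" if "y \<in> S" for y
    using x(2)[OF that] diff[OF that] diff[OF x(1)] by auto
  then show thesis using that x(1) by blast
qed

lemma prefix_set_subset: "w permutes {1..n} \<Longrightarrow> k \<le> n \<Longrightarrow> prefix_set w k \<subseteq> {1..n}"
  unfolding prefix_set_def by (rule subset_trans[OF image_mono equalityD1[OF permutes_image]]) auto

lemma card_prefix_set: "w permutes {1..n} \<Longrightarrow> card (prefix_set w k) = k"
  unfolding prefix_set_def by (subst card_image) (auto intro: permutes_inj_on)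

lemma card_prefix_set_Suc:
  assumes "w permutes {1..n}" "k < n"
  shows "card (prefix_set w (Suc k) \<inter> {1..<a}) =
    card (prefix_set w k \<inter> {1..<a}) + (if w (Suc k) < a then 1 else 0)"
proof -
  have "w (Suc k) \<notin> prefix_set w k"
    using inj_image_mem_iff[OF permutes_inj[OF assms(1)], of "Suc k" "{1..k}"]
    by (simp add: prefix_set_def)
  moreover have "w (Suc k) \<in> {1..n}"
    using assms permutes_in_image[of w "{1..n}" "Suc k"] by simp
  moreover have "prefix_set w (Suc k) = insert (w (Suc k)) (prefix_set w k)"
    by (simp add: prefix_set_def atLeastAtMostSuc_conv)
  ultimately show ?thesis
    by (auto simp: prefix_set_def)
qed

lemma ex_common_minimum_prefix_diff:
  assumes "u permutes {1..n}" "v permutes {1..n}" "k < n"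
  obtains a where "a \<in> {1..n}"
    "\<And>b. b \<in> {1..n} \<Longrightarrow>
      prefix_diff (prefix_set u k) (prefix_set v k) a
        \<le> prefix_diff (prefix_set u k) (prefix_set v k) b"
    "\<And>b. b \<in> {1..n} \<Longrightarrow>
      prefix_diff (prefix_set u (Suc k)) (prefix_set v (Suc k)) a
        \<le> prefix_diff (prefix_set u (Suc k)) (prefix_set v (Suc k)) b"
proof -
  \<comment> \<open>The new letters change the difference at \<open>x\<close> by 1 if only
    \<open>u (Suc k) < x\<close>, by -1 if only \<open>v (Suc k) < x\<close>, and by 0 otherwise.
    Their order decides which sign can occur.\<close>
  define c :: int where "c = (if u (Suc k) \<le> v (Suc k) then 0 else - 1)"
  have diff: "prefix_diff (prefix_set u (Suc k)) (prefix_set v (Suc k)) x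
      - prefix_diff (prefix_set u k) (prefix_set v k) x \<in> {c, c + 1}" for x
    unfolding prefix_diff_def card_prefix_set_Suc[OF assms(1,3)] card_prefix_set_Suc[OF assms(2,3)]
    by (auto simp: c_def)
  show thesis
    by (rule common_minimum[where S = "{1..n}"
          and f = "prefix_diff (prefix_set u k) (prefix_set v k)", OF _ _ diff])
      (use assms(3) that in auto)
qed

theorem theorem3p12:
  fixes n :: nat and u v :: "nat \<Rightarrow> nat"
  assumes "u permutes {1..n}" and "v permutes {1..n}"
  shows "(\<exists>a \<in> {1..n} \<rightarrow>\<^sub>E {1..n}. seq_le n a u v) \<and>
         (\<exists>a \<in> {1..n} \<rightarrow>\<^sub>E {1..n}. seq_lesssim n a u v)"
proof -
  define D where "D k = prefix_diff (prefix_set u k) (prefix_set v k)" for k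
  \<comment> \<open>Minimality for \<open>D k\<close> gives the Gale comparison at \<open>k\<close>;
    minimality for \<open>D (k - 1)\<close> links the choice to the preceding one. For
    \<open>k = 1\<close> the latter is vacuous, as \<open>D 0\<close> is constantly 0.\<close>
  have "\<exists>a\<in>{1..n}. \<forall>b\<in>{1..n}. D (k - 1) a \<le> D (k - 1) b \<and> D k a \<le> D k b"
    if "k \<in> {1..n}" for k
    proof -
    from that have "k - 1 < n" "Suc (k - 1) = k" by auto
    then show ?thesis
      using ex_common_minimum_prefix_diff[OF assms, of "k - 1"] unfolding D_def by metis
  qed
  then have "\<forall>k\<in>{1..n}. \<exists>a. a \<in> {1..n} \<and>
      (\<forall>b\<in>{1..n}. D (k - 1) a \<le> D (k - 1) b \<and> D k a \<le> D k b)"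
    by blast
  from bchoice[OF this] obtain a0 where a0: "\<And>k. k \<in> {1..n} \<Longrightarrow> a0 k \<in> {1..n} \<and>
      (\<forall>b\<in>{1..n}. D (k - 1) (a0 k) \<le> D (k - 1) b \<and> D k (a0 k) \<le> D k b)"
    by blast
  \<comment> \<open>Restriction makes the choice extensional, as
    \<open>\<rightarrow>\<^sub>E\<close> demands.\<close>
  define a where "a = restrict a0 {1..n}"
  have a_in: "a \<in> {1..n} \<rightarrow>\<^sub>E {1..n}"
    using a0 by (auto simp: a_def)
  have a: "a k \<in> {1..n}" "\<And>b. b \<in> {1..n} \<Longrightarrow> D (k - 1) (a k) \<le> D (k - 1) b"
    "\<And>b. b \<in> {1..n} \<Longrightarrow> D k (a k) \<le> D k b" if "k \<in> {1..n}" for k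
    using a0[OF that] that by (simp_all add: a_def)
  have sub: "prefix_set u k \<subseteq> {1..n}" "prefix_set v k \<subseteq> {1..n}" if "k \<le> n" for k
    using prefix_set_subset[OF assms(1) that] prefix_set_subset[OF assms(2) that] .
  have card: "card (prefix_set u k) = card (prefix_set v k)" for k
    using assms by (simp add: card_prefix_set)
  have le: "seq_le n a u v"
    unfolding seq_le_def
  proof
    fix k assume "k \<in> {1..n}"
    then show "gale_le (a k) (prefix_set u k) (prefix_set v k)"
      using a(1,3)[of k] gale_le_if_minimum[OF sub card] by (simp add: D_def)
  qed
  have "seq_sim n a u v"
    unfolding seq_sim_def
  proof
    fix k assume k: "k \<in> {1..<n}"
    \<comment> \<open>Both points minimise \<open>D k\<close>: \<open>a k\<close> as the later of
      its two functions, \<open>a (Suc k)\<close> as the earlier.\<close>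
    have "D k (a k) = D k (a (Suc k))"
      using a(3)[of k "a (Suc k)"] a(2)[of "Suc k" "a k"] a(1)[of k] a(1)[of "Suc k"] k
      by (simp add: antisym)
    then show "card (prefix_set u k \<inter> cyclic_interval n (a k) (a (Suc k)))
        = card (prefix_set v k \<inter> cyclic_interval n (a k) (a (Suc k)))"
      using card_cyclic_interval_eq_iff[OF sub card] a(1)[of k] a(1)[of "Suc k"] k
      by (simp add: D_def)
  qed
  then show ?thesis
    using a_in le by (auto simp: seq_lesssim_def)
qed

end
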